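(* Let $(\lambda_n)_{n\ge 1}$ be a sequence of non-zero complex numbers such that $$\liminf_{n\to+\infty}\frac{|\lambda_{n+1}|}{|\lambda_n|}>2.$$ Then for every non-degenerate line segment $I\subseteq\mathbb{C}\setminus\{0\}$ the set $\bigcap_{b\in I}HC(\{T_{\lambda_n b}\})$ is empty. In particular, $\bigcap_{b\in\mathbb{C}\setminus\{0\}}HC(\{T_{\lambda_n b}\})=\emptyset$.
   Context: $\mathcal{H}(\mathbb{C})$ denotes the space of entire functions endowed with the topology of local uniform convergence (uniform convergence on compact subsets of $\mathbb{C}$). For $b\in\mathbb{C}\setminus\{0\}$, the translation operator $T_b:\mathcal{H}(\mathbb{C})\to\mathcal{H}(\mathbb{C})$ is defined by $T_b(f)(z)=f(z+b)$ for $f\in\mathcal{H}(\mathbb{C})$, $z\in\mathbb{C}$. For a sequence $(S_n)_{n\ge1}$ of continuous linear operators on a topological vector space $X$, $HC(\{S_n\})$ denotes the set of all hypercyclic vectors for $(S_n)$, that is, the set of all $x\in X$ such that $\{S_n(x): n=1,2,\ldots\}$ is dense in $X$. Thus $HC(\{T_{\lambda_n b}\})$ is the set of entire functions $f$ such that the set of functions $\{z\mapsto f(z+\lambda_n b): n=1,2,\ldots\}$ is dense in $\mathcal{H}(\mathbb{C})$. The limit inferior in the hypothesis is allowed to be $+\infty$. *)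

theory Defs
  imports "HOL-Complex_Analysis.Complex_Analysis"
begin

definition entire_functions :: "(complex \<Rightarrow> complex) set" where
  "entire_functions = {f. f holomorphic_on UNIV}"

text \<open>The space of entire functions with the topology of uniform convergence on compact sets,
  as a topology on the carrier \<^const>\<open>entire_functions\<close>. The neighbourhoods of \<open>f\<close> are the supersets
  of the sets of all entire \<open>g\<close> with \<open>dist (f z) (g z) < e\<close> on \<open>K\<close>, for \<open>K\<close> compact and \<open>e > 0\<close>.\<close>

definition entire_topology :: "(complex \<Rightarrow> complex) topology" where
  "entire_topology = topology (\<lambda>U. U \<subseteq> entire_functions \<and>
     (\<forall>f\<in>U. \<exists>K e. compact K \<and> 0 < e \<and>
        {g \<in> entire_functions. \<forall>z\<in>K. dist (f z) (g z) < e} \<subseteq> U))"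

lemma openin_entire_topology:
  "openin entire_topology U \<longleftrightarrow> U \<subseteq> entire_functions \<and>
     (\<forall>f\<in>U. \<exists>K e. compact K \<and> 0 < e \<and>
        {g \<in> entire_functions. \<forall>z\<in>K. dist (f z) (g z) < e} \<subseteq> U)"
proof -
  define N where "N = (\<lambda>f K (e::real). {g \<in> entire_functions. \<forall>z\<in>K. dist (f z) (g z) < e})"
  have "istopology (\<lambda>U. U \<subseteq> entire_functions \<and>
     (\<forall>f\<in>U. \<exists>K e. compact K \<and> 0 < e \<and> N f K e \<subseteq> U))"
    unfolding istopology_def
  proof (rule conjI; intro allI impI)
    fix S T
    assume S: "S \<subseteq> entire_functions \<and> (\<forall>f\<in>S. \<exists>K e. compact K \<and> 0 < e \<and> N f K e \<subseteq> S)"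
      and T: "T \<subseteq> entire_functions \<and> (\<forall>f\<in>T. \<exists>K e. compact K \<and> 0 < e \<and> N f K e \<subseteq> T)"
    have "\<exists>K e. compact K \<and> 0 < e \<and> N f K e \<subseteq> S \<inter> T" if f: "f \<in> S \<inter> T" for f
    proof -
      from S f obtain K e where 1: "compact K" "0 < e" "N f K e \<subseteq> S" by blast
      from T f obtain L d where 2: "compact L" "0 < d" "N f L d \<subseteq> T" by blast
      have "N f (K \<union> L) (min e d) \<subseteq> N f K e \<inter> N f L d"
        by (auto simp: N_def)
      with 1 2 have "compact (K \<union> L) \<and> 0 < min e d \<and> N f (K \<union> L) (min e d) \<subseteq> S \<inter> T"
        by auto
      then show ?thesis by blast
    qed
    with S show "S \<inter> T \<subseteq> entire_functions \<and>
        (\<forall>f\<in>S \<inter> T. \<exists>K e. compact K \<and> 0 < e \<and> N f K e \<subseteq> S \<inter> T)"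
      by blast
  next
    fix \<K>
    assume "\<forall>S\<in>\<K>. S \<subseteq> entire_functions \<and> (\<forall>f\<in>S. \<exists>K e. compact K \<and> 0 < e \<and> N f K e \<subseteq> S)"
    then show "\<Union>\<K> \<subseteq> entire_functions \<and>
        (\<forall>f\<in>\<Union>\<K>. \<exists>K e. compact K \<and> 0 < e \<and> N f K e \<subseteq> \<Union>\<K>)"
      by (meson Sup_least UnionE Union_upper order_trans)
  qed
  then show ?thesis
    unfolding entire_topology_def N_def by (simp add: topology_inverse')
qed

lemma topspace_entire_topology [simp]: "topspace entire_topology = entire_functions"
proof
  show "topspace entire_topology \<subseteq> entire_functions"
    using openin_entire_topology openin_topspace by blast
  have "openin entire_topology entire_functions"
    unfolding openin_entire_topology by (auto intro!: exI[of _ "{}"] exI[of _ "1::real"])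
  then show "entire_functions \<subseteq> topspace entire_topology"
    by (rule openin_subset)
qed

lemma openin_entire_topology_basic:
  assumes f: "f \<in> entire_functions" and K: "compact K"
  shows "openin entire_topology {g \<in> entire_functions. \<forall>z\<in>K. dist (f z) (g z) < e}"
proof -
  have "\<exists>L d. compact L \<and> 0 < d \<and> {h \<in> entire_functions. \<forall>z\<in>L. dist (g z) (h z) < d}
      \<subseteq> {g \<in> entire_functions. \<forall>z\<in>K. dist (f z) (g z) < e}"
    if g: "g \<in> entire_functions" "\<forall>z\<in>K. dist (f z) (g z) < e" for g
  proof (cases "K = {}")
    case True
    then show ?thesis by (auto intro!: exI[of _ "{}"] exI[of _ "1::real"])
  next
    case False
    have "continuous_on K (\<lambda>z. dist (f z) (g z))"
      using f g(1) unfolding entire_functions_def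
      by (intro continuous_intros)
        (auto intro: continuous_on_subset dest!: holomorphic_on_imp_continuous_on)
    from continuous_attains_sup[OF K False this] obtain w
      where w: "w \<in> K" "\<And>z. z \<in> K \<Longrightarrow> dist (f z) (g z) \<le> dist (f w) (g w)" by blast
    define d where "d = e - dist (f w) (g w)"
    have "d > 0" using g(2) w(1) by (simp add: d_def)
    moreover have "dist (f z) (h z) < e" if "z \<in> K" "dist (g z) (h z) < d" for h z
      using w(2)[OF that(1)] that(2) dist_triangle[of "f z" "h z" "g z"] by (simp add: d_def)
    ultimately show ?thesis
      using K by (intro exI[of _ K] exI[of _ d]) auto
  qed
  then show ?thesis unfolding openin_entire_topology by blast
qed

lemma limitin_entire_topology:
  assumes "\<And>n. F n \<in> entire_functions"
  shows "limitin entire_topology F f sequentially \<longleftrightarrow>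
    f \<in> entire_functions \<and> (\<forall>K. compact K \<longrightarrow> uniform_limit K F f sequentially)"
proof (intro iffI conjI allI impI)
  assume L: "limitin entire_topology F f sequentially"
  then show f: "f \<in> entire_functions" by (simp add: limitin_def)
  fix K :: "complex set" assume K: "compact K"
  show "uniform_limit K F f sequentially"
  proof (rule uniform_limitI)
    fix e :: real assume "0 < e"
    then have "f \<in> {g \<in> entire_functions. \<forall>z\<in>K. dist (f z) (g z) < e}" using f by simp
    with L openin_entire_topology_basic[OF f K, of e]
    have "\<forall>\<^sub>F n in sequentially. F n \<in> {g \<in> entire_functions. \<forall>z\<in>K. dist (f z) (g z) < e}"
      unfolding limitin_def by blast
    then show "\<forall>\<^sub>F n in sequentially. \<forall>z\<in>K. dist (F n z) (f z) < e"
      by (rule eventually_mono) (simp add: dist_commute)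
  qed
next
  assume R: "f \<in> entire_functions \<and> (\<forall>K. compact K \<longrightarrow> uniform_limit K F f sequentially)"
  show "limitin entire_topology F f sequentially"
    unfolding limitin_def
  proof (intro conjI allI impI)
    show "f \<in> topspace entire_topology" using R by simp
    fix U assume "openin entire_topology U \<and> f \<in> U"
    then obtain K e where K: "compact K" "0 < e"
      "{g \<in> entire_functions. \<forall>z\<in>K. dist (f z) (g z) < e} \<subseteq> U"
      unfolding openin_entire_topology by blast
    from R K(1,2) have "\<forall>\<^sub>F n in sequentially. \<forall>z\<in>K. dist (F n z) (f z) < e"
      by (auto dest: uniform_limitD)
    then show "\<forall>\<^sub>F n in sequentially. F n \<in> U"
      by (rule eventually_mono) (use K(3) assms in \<open>auto simp: dist_commute\<close>)
  qed
qed

definition translation :: "complex \<Rightarrow> (complex \<Rightarrow> complex) \<Rightarrow> complex \<Rightarrow> complex" where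
  "translation b f = (\<lambda>z. f (z + b))"

lemma translation_entire: "f \<in> entire_functions \<Longrightarrow> translation b f \<in> entire_functions"
  using holomorphic_on_compose_gen[of "\<lambda>z. z + b" UNIV f UNIV]
  by (simp add: entire_functions_def translation_def o_def holomorphic_intros)

lemma continuous_map_translation:
  "continuous_map entire_topology entire_topology (translation b)"
  unfolding continuous_map_def
proof (intro conjI allI impI)
  show "translation b \<in> topspace entire_topology \<rightarrow> topspace entire_topology"
    by (auto intro: translation_entire)
  fix U assume U: "openin entire_topology U"
  have "\<exists>K e. compact K \<and> 0 < e \<and> {g \<in> entire_functions. \<forall>z\<in>K. dist (f z) (g z) < e}
      \<subseteq> {f \<in> entire_functions. translation b f \<in> U}" if "translation b f \<in> U" for f
  proof -
    from U that obtain K e where K: "compact K" "0 < e"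
      "{g \<in> entire_functions. \<forall>z\<in>K. dist (translation b f z) (g z) < e} \<subseteq> U"
      unfolding openin_entire_topology by blast
    have "compact ((\<lambda>z. z + b) ` K)"
      using K(1) by (intro compact_continuous_image continuous_intros)
    moreover have "{g \<in> entire_functions. \<forall>z\<in>(\<lambda>z. z + b) ` K. dist (f z) (g z) < e}
      \<subseteq> {f \<in> entire_functions. translation b f \<in> U}"
    proof safe
      fix g assume g: "g \<in> entire_functions" "\<forall>z\<in>(\<lambda>z. z + b) ` K. dist (f z) (g z) < e"
      then show "translation b g \<in> U"
        using K(3) translation_entire[OF g(1), of b] by (auto simp: translation_def)
    qed
    ultimately show ?thesis using K(2) by blast
  qed
  then show "openin entire_topology {f \<in> topspace entire_topology. translation b f \<in> U}"
    by (subst openin_entire_topology) auto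
qed

text \<open>Sequences of operators are indexed by \<open>n \<ge> 1\<close>; the value at \<open>0\<close> is ignored.\<close>

definition HC :: "'a topology \<Rightarrow> (nat \<Rightarrow> 'a \<Rightarrow> 'a) \<Rightarrow> 'a set" where
  "HC X S = {x \<in> topspace X. X closure_of {S n x | n. 1 \<le> n} = topspace X}"

text \<open>Each endpoint may or may not belong to the segment.\<close>

definition nondegenerate_segment :: "complex set \<Rightarrow> bool" where
  "nondegenerate_segment I \<longleftrightarrow>
     (\<exists>p q. p \<noteq> q \<and> open_segment p q \<subseteq> I \<and> I \<subseteq> closed_segment p q)"

end

(* Fix 2 < q < liminf and call w bad if f (w + z) is within (q - 2)/2 of z for all |z| <= q.
   Two bad points at distance at most q are in fact at distance less than q - 2, because f is
   close both to 0 and to their difference at one of them. So a segment of length q has an end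
   piece of length 1 free of bad points. Since |l (n+1)| >= q |l n| eventually, nested intervals
   give a b in I with l n * b not bad for all large n. On the other hand, density of the
   translates would make l n * b bad for arbitrarily large n. *)

theory Submission
  imports Defs
begin

text \<open>The intervals \<open>J n x\<close> have length \<open>1 / a n\<close>. In units of
  \<open>1 / a (Suc n)\<close> this is at least \<open>q\<close>, which leaves room to choose
  between two disjoint subintervals of unit length at the next stage.\<close>

lemma nested_intervals_avoiding:
  fixes a :: "nat \<Rightarrow> real" and B :: "nat \<Rightarrow> real set"
  assumes q: "2 < q"
    and pos: "\<And>n. 0 < a n"
    and growth: "\<And>n. q * a n \<le> a (Suc n)"
    and separated: "\<And>n s t. s \<in> B n \<Longrightarrow> t \<in> B n \<Longrightarrow> a n * \<bar>s - t\<bar> \<le> q \<Longrightarrow> a n * \<bar>s - t\<bar> < q - 2"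
  obtains t where "u \<le> t" "t \<le> u + 1 / a 0" "\<And>n. t \<notin> B (Suc n)"
proof -
  define J where "J = (\<lambda>n x. {x .. x + 1 / a n})"
  have step: "\<exists>y. J (Suc n) y \<subseteq> J n x \<and> J (Suc n) y \<inter> B (Suc n) = {}" for n x
  proof -
    define c where "c = a (Suc n)"
    have c: "0 < c" using pos by (simp add: c_def)
    have len: "q / c \<le> 1 / a n"
      using growth[of n] pos[of n] c by (simp add: c_def field_simps)
    \<comment> \<open>Left endpoint of the last piece of length \<open>1 / c\<close> in
      \<open>[x, x + q / c]\<close>. Its gap to the first piece \<open>[x, x + 1 / c]\<close> is
      \<open>(q - 2) / c\<close>.\<close>
    define y where "y = x + (q - 1) / c"
    have y_end: "y + 1 / c = x + q / c"
      by (simp add: y_def diff_divide_distrib)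
    have "x \<le> y" "x + 1 / c \<le> x + q / c"
      using q c by (simp_all add: y_def divide_right_mono)
    then have sub: "J (Suc n) x \<subseteq> J n x" "J (Suc n) y \<subseteq> J n x"
      using len y_end by (auto simp: J_def c_def)
    \<comment> \<open>Points of \<open>B (Suc n)\<close> in both pieces would have scaled distance
      between \<open>q - 2\<close> and \<open>q\<close>, the range that \<open>separated\<close>
      excludes.\<close>
    have "J (Suc n) x \<inter> B (Suc n) = {} \<or> J (Suc n) y \<inter> B (Suc n) = {}"
    proof (rule ccontr)
      assume "\<not> ?thesis"
      then obtain s t where st: "s \<in> B (Suc n)" "t \<in> B (Suc n)"
        "x \<le> s" "s \<le> x + 1 / c" "y \<le> t" "t \<le> x + q / c"
        unfolding J_def c_def[symmetric] using y_end by fastforce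
      have "(q - 2) / c \<le> t - s"
        using st y_def by (simp add: diff_divide_distrib)
      then have lower: "q - 2 \<le> c * (t - s)"
        using c by (simp add: field_simps)
      have "t - s \<le> q / c"
        using st by simp
      then have upper: "c * (t - s) \<le> q"
        using c by (simp add: field_simps)
      have "0 \<le> c * (t - s)" using lower q by linarith
      then have "\<bar>t - s\<bar> = t - s"
        using c by (simp add: zero_le_mult_iff)
      then show False
        using separated[OF st(2,1)] lower upper by (simp add: c_def)
    qed
    then show ?thesis using sub by blast
  qed
  \<comment> \<open>The starting interval is prescribed and may meet \<open>B 0\<close>, so
    avoidance begins at index 1.\<close>
  have "\<exists>x. \<forall>n. (n = 0 \<longrightarrow> x n = u) \<and>
      (J (Suc n) (x (Suc n)) \<subseteq> J n (x n) \<and> J (Suc n) (x (Suc n)) \<inter> B (Suc n) = {})"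
    using dependent_nat_choice[of "\<lambda>n y. n = 0 \<longrightarrow> y = u"
        "\<lambda>n x y. J (Suc n) y \<subseteq> J n x \<and> J (Suc n) y \<inter> B (Suc n) = {}"] step
    by blast
  then obtain x where x0: "x 0 = u"
    and nest: "\<And>n. J (Suc n) (x (Suc n)) \<subseteq> J n (x n)"
    and avoid: "\<And>n. J (Suc n) (x (Suc n)) \<inter> B (Suc n) = {}"
    by blast
  have "(\<Inter>n. J n (x n)) \<noteq> {}"
  proof (rule compact_nest)
    show "compact (J n (x n))" "J n (x n) \<noteq> {}" for n
      using pos[of n] by (simp_all add: J_def)
    show "J n (x n) \<subseteq> J m (x m)" if "m \<le> n" for m n
      using lift_Suc_antimono_le[of "\<lambda>n. J n (x n)", OF nest that] .
  qed
  then obtain t where t: "\<And>n. t \<in> J n (x n)" by blast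
  show thesis
  proof (rule that)
    show "u \<le> t" "t \<le> u + 1 / a 0"
      using t[of 0] x0 by (auto simp: J_def)
    show "t \<notin> B (Suc n)" for n
      using t[of "Suc n"] avoid[of n] by blast
  qed
qed

lemma near_identity_points_separated:
  fixes f :: "'a :: real_normed_vector \<Rightarrow> 'a"
  assumes "\<And>z. norm z \<le> r \<Longrightarrow> dist z (f (z + v)) < e"
    and "\<And>z. norm z \<le> r \<Longrightarrow> dist z (f (z + w)) < e"
    and "dist v w \<le> r"
  shows "dist v w < 2 * e"
proof -
  have "0 \<le> r" using assms(3) zero_le_dist order_trans by blast
  then have "dist 0 (f w) < e"
    using assms(2)[of 0] by simp
  moreover have "dist (w - v) (f w) < e"
    using assms(1)[of "w - v"] assms(3) by (simp add: dist_norm norm_minus_commute)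
  ultimately have "dist (w - v) 0 < 2 * e"
    by metric
  then show ?thesis by (simp add: dist_norm norm_minus_commute)
qed

text \<open>To skip the first \<open>N\<close> translates, perturb the target by a small constant so that none of
  them agrees with it at \<open>0\<close>.\<close>

lemma HC_translation_recurrent:
  assumes f: "f \<in> HC entire_topology (\<lambda>n. translation (m n))"
    and g: "g \<in> entire_functions" and K: "compact K" and e: "0 < e"
  obtains n where "N < n" "\<And>z. z \<in> K \<Longrightarrow> dist (g z) (f (z + m n)) < e"
proof -
  define F where "F = (\<lambda>n. f (m n)) ` {..N}"
  have "infinite (ball (g 0) (e / 2))"
    using e uncountable_ball[of "e / 2" "g 0"] countable_finite by auto
  moreover have "finite F" by (simp add: F_def)
  ultimately have "\<not> ball (g 0) (e / 2) \<subseteq> F"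
    using finite_subset by blast
  then obtain p where p: "dist (g 0) p < e / 2" "p \<notin> F" by (metis mem_ball subsetI)
  obtain d where d: "0 < d" "\<And>x. x \<in> F \<Longrightarrow> d \<le> dist p x"
    using finite_set_avoid[OF \<open>finite F\<close>, of p] p(2) by metis
  define h where "h = (\<lambda>z. g z + (p - g 0))"
  have h: "h \<in> entire_functions"
    using g by (auto simp: h_def entire_functions_def intro!: holomorphic_intros)
  have gh: "dist (g z) (h z) < e / 2" for z
    using p(1) by (simp add: h_def dist_norm norm_minus_commute)
  \<comment> \<open>Adding 0 to \<open>K\<close> controls \<open>f (m n)\<close>: closeness below
    \<open>d\<close> to \<open>p = h 0\<close> keeps it out of \<open>F\<close>, hence
    \<open>n\<close> exceeds \<open>N\<close>. The other half of \<open>e\<close> pays for replacing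
    \<open>g\<close> by \<open>h\<close>.\<close>
  define U where "U = {k \<in> entire_functions. \<forall>z\<in>insert 0 K. dist (h z) (k z) < min d (e / 2)}"
  have "openin entire_topology U"
    unfolding U_def using h K by (intro openin_entire_topology_basic) auto
  moreover have "h \<in> U"
    using h d(1) e by (simp add: U_def)
  moreover have "h \<in> entire_topology closure_of {translation (m n) f | n. 1 \<le> n}"
    using f h by (simp add: HC_def)
  ultimately obtain n where "translation (m n) f \<in> U"
    unfolding in_closure_of by blast
  then have near: "dist (h z) (f (z + m n)) < min d (e / 2)" if "z \<in> insert 0 K" for z
    using that by (auto simp: U_def translation_def)
  have "dist p (f (m n)) < d"
    using near[of 0] by (simp add: h_def)
  then have "f (m n) \<notin> F" using d(2) by force
  then have "N < n" by (auto simp: F_def not_le[symmetric])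
  moreover have "dist (g z) (f (z + m n)) < e" if "z \<in> K" for z
    using near[of z] gh[of z] that dist_triangle[of "g z" "f (z + m n)" "h z"] by simp
  ultimately show thesis using that by blast
qed

text \<open>Ratios that eventually exceed some \<open>q > 1\<close> force geometric growth, so
  \<open>N\<close> can be moved on until the norm passes any prescribed \<open>C\<close>.\<close>

lemma liminf_ratio_obtains:
  fixes l :: "nat \<Rightarrow> 'a :: real_normed_vector"
  assumes nz: "\<And>n. 1 \<le> n \<Longrightarrow> l n \<noteq> 0"
    and lim: "liminf (\<lambda>n. ereal (norm (l (n + 1)) / norm (l n))) > ereal r"
    and r: "1 \<le> r"
  obtains q N where "r < q" "1 \<le> N" "C \<le> norm (l N)"
    "\<And>n. N \<le> n \<Longrightarrow> q * norm (l n) \<le> norm (l (Suc n))"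
proof -
  obtain q where q: "r < q" "ereal q < liminf (\<lambda>n. ereal (norm (l (n + 1)) / norm (l n)))"
    using ereal_dense2[OF lim] by auto
  from less_LiminfD[OF q(2)] obtain M where
    M: "\<And>n. M \<le> n \<Longrightarrow> q < norm (l (n + 1)) / norm (l n)"
    by (auto simp: eventually_sequentially)
  \<comment> \<open>\<open>l 0\<close> may vanish, so the ratios are used only from index 1
    on.\<close>
  define L where "L = max 1 M"
  have growth: "q * norm (l n) \<le> norm (l (Suc n))" if "L \<le> n" for n
    using M[of n] nz[of n] that by (simp add: L_def field_simps)
  have geometric: "q ^ k * norm (l L) \<le> norm (l (L + k))" for k
  proof (induction k)
    case (Suc k)
    have "q ^ Suc k * norm (l L) \<le> q * norm (l (L + k))"
      using Suc q(1) r by (simp add: mult.assoc)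
    also have "\<dots> \<le> norm (l (L + Suc k))"
      using growth[of "L + k"] by simp
    finally show ?case .
  qed simp
  have L: "0 < norm (l L)" using nz[of L] by (simp add: L_def)
  obtain k where "C / norm (l L) < q ^ k"
    using real_arch_pow[of q "C / norm (l L)"] q(1) r by auto
  then have "C \<le> norm (l (L + k))"
    using geometric[of k] L by (simp add: field_simps)
  then show thesis
    using that[of q "L + k"] q(1) growth by (simp add: L_def)
qed

lemma HC_translation_segment_empty:
  fixes l :: "nat \<Rightarrow> complex"
  assumes nz: "\<And>n. 1 \<le> n \<Longrightarrow> l n \<noteq> 0"
    and lim: "liminf (\<lambda>n. ereal (cmod (l (n + 1)) / cmod (l n))) > 2"
    and pq: "p \<noteq> q"
  shows "(\<Inter>b\<in>open_segment p q. HC entire_topology (\<lambda>n. translation (l n * b))) = {}"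
proof (rule equals0I)
  fix f
  assume f: "f \<in> (\<Inter>b\<in>open_segment p q. HC entire_topology (\<lambda>n. translation (l n * b)))"
  define d where "d = cmod (q - p)"
  have d: "0 < d" using pq by (simp add: d_def)
  \<comment> \<open>\<open>r\<close> is the growth factor, since \<open>q\<close> names an endpoint
    here. The bound \<open>2 / d\<close> gives \<open>1 / a 0 \<le> 1 / 2\<close>, so an interval
    starting at \<open>1 / 4\<close> stays inside the open unit interval.\<close>
  obtain r N where r: "2 < r" and N: "1 \<le> N" "2 / d \<le> cmod (l N)"
    and growth: "\<And>n. N \<le> n \<Longrightarrow> r * cmod (l n) \<le> cmod (l (Suc n))"
    by (rule liminf_ratio_obtains[of l 2 "2 / d"]) (use nz lim in auto)
  define b where "b = (\<lambda>t. p + of_real t * (q - p))"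
  \<comment> \<open>The factor by which \<open>t \<mapsto> l (N + n) * b t\<close> stretches
    distances.\<close>
  define a where "a = (\<lambda>n. d * cmod (l (N + n)))"
  \<comment> \<open>Parameters of bad points; twice the tolerance is exactly the required separation
    \<open>r - 2\<close>.\<close>
  define B where "B = (\<lambda>n. {t. \<forall>z\<in>cball 0 r. dist z (f (z + l (N + n) * b t)) < (r - 2) / 2})"
  have dist_b: "dist (l (N + n) * b s) (l (N + n) * b t) = a n * \<bar>s - t\<bar>" for n s t
  proof -
    have "l (N + n) * b s - l (N + n) * b t = l (N + n) * (q - p) * of_real (s - t)"
      by (simp add: b_def algebra_simps)
    then show ?thesis
      by (simp only: dist_norm norm_mult norm_of_real) (simp add: a_def d_def)
  qed
  obtain t where t: "1 / 4 \<le> t" "t \<le> 1 / 4 + 1 / a 0" "\<And>n. t \<notin> B (Suc n)"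
  proof (rule nested_intervals_avoiding[of r a B "1 / 4"])
    show "0 < a n" for n
      using d nz[of "N + n"] N by (simp add: a_def)
    show "r * a n \<le> a (Suc n)" for n
      using mult_left_mono[OF growth[of "N + n"], of d] d by (simp add: a_def mult.left_commute)
    show "a n * \<bar>s - t\<bar> < r - 2" if "s \<in> B n" "t \<in> B n" "a n * \<bar>s - t\<bar> \<le> r" for n s t
      using near_identity_points_separated[of r f "l (N + n) * b s" "(r - 2) / 2" "l (N + n) * b t"]
        that by (simp add: B_def dist_b)
  qed (use r in auto)
  have "2 \<le> a 0" using N d by (simp add: a_def field_simps)
  then have "1 / a 0 \<le> 1 / 2" by (simp add: field_simps)
  then have "0 < t" "t < 1" using t(1,2) by linarith+
  then have "b t \<in> open_segment p q"
    using pq by (auto simp: in_segment b_def scaleR_conv_of_real algebra_simps intro!: exI[of _ t])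
  then have "f \<in> HC entire_topology (\<lambda>n. translation (l n * b t))"
    using f by blast
  then obtain n where n: "N < n" "\<And>z. z \<in> cball 0 r \<Longrightarrow> dist z (f (z + l n * b t)) < (r - 2) / 2"
    by (rule HC_translation_recurrent[of f _ "\<lambda>z. z" "cball 0 r" "(r - 2) / 2" N])
      (use r in \<open>auto simp: entire_functions_def\<close>)
  \<comment> \<open>The strict inequality \<open>N < n\<close> matters: \<open>t\<close> may lie in
    \<open>B 0\<close>, which belongs to index \<open>N\<close>.\<close>
  obtain k where "n = N + Suc k"
    using less_imp_Suc_add[OF n(1)] by auto
  with n(2) t(3)[of k] show False by (simp add: B_def)
qed

theorem theorem1p1:
  fixes l :: "nat \<Rightarrow> complex"
  assumes "\<And>n. 1 \<le> n \<Longrightarrow> l n \<noteq> 0"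
    and "liminf (\<lambda>n. ereal (cmod (l (n + 1)) / cmod (l n))) > 2"
  shows "(\<forall>I. nondegenerate_segment I \<and> I \<subseteq> UNIV - {0} \<longrightarrow>
            (\<Inter>b\<in>I. HC entire_topology (\<lambda>n. translation (l n * b))) = {})
       \<and> (\<Inter>b\<in>UNIV - {0}. HC entire_topology (\<lambda>n. translation (l n * b))) = {}"
proof -
  \<comment> \<open>Enlarging the index set shrinks the intersection, so one open segment inside
    \<open>I\<close> suffices.\<close>
  have empty: "(\<Inter>b\<in>I. HC entire_topology (\<lambda>n. translation (l n * b))) = {}"
    if "p \<noteq> q" "open_segment p q \<subseteq> I" for I p q
    using HC_translation_segment_empty[OF assms that(1)] INF_superset_mono[OF that(2) order_refl]
    by blast
  have "open_segment (0::complex) 1 \<subseteq> UNIV - {0}"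
    by (auto simp: open_segment_def)
  then show ?thesis
    using empty[of 0 1 "UNIV - {0}"] empty
    unfolding nondegenerate_segment_def by (metis zero_neq_one)
qed

end
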